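(* Let $G=(V,E)$ be a tree with $1<|V|<\infty$ and edge weights $q\in(0,\infty)^E$. Fix $a=(a_v)_{v\in V}\in(0,\infty)^V$ and $\beta>0$. For any $\varepsilon>0$ such that $\varepsilon a\in(0,\beta)^V$ let $K^{(\varepsilon)}$ be a random vector with the second kind tree-beta distribution, $$K^{(\varepsilon)}\sim \mathrm{TB}^G_{\mathrm{II}}(a,\beta/\varepsilon,q/\varepsilon).$$ Then, as $\varepsilon\to0$, $\varepsilon^{-1}K^{(\varepsilon)}$ converges in distribution to a random vector $K\sim \mathrm{TK}^G(a,\beta,q)$.
   Context: For $U\subseteq V$ let $G_U=(U,E_U)$ be the induced subgraph of $G$ ($E_U$ is the set of edges of $G$ with both ends in $U$), $k^U=\prod_{v\in U}k_v$, $q^{E_U}=\prod_{e\in E_U}q_e$ (empty products equal $1$). Second kind tree-beta law: for $\beta>0$, $a\in(0,\beta)^V$, $q\in(0,\infty)^E$, $\mathrm{TB}^G_{\mathrm{II}}(a,\beta,q)$ is the probability law on $\mathbb R^V$ with Lebesgue density proportional to $$\Bigl(\sum_{U\subseteq V}q^{E_U}k^U\Bigr)^{-\beta}\prod_{v\in V}k_v^{a_v-1}\,\mathbf 1_{(0,\infty)^V}(k).$$ Tree-Kummer law: for $a\in(0,\infty)^V$, $\beta>0$, $q\in(0,\infty)^E$, $\mathrm{TK}^G(a,\beta,q)$ is the probability law on $\mathbb R^V$ with Lebesgue density proportional to $$\exp\Bigl(-\beta\sum_{\varnothing\neq U\subseteq V,\ G_U\text{ is a tree}}q^{E_U}k^U\Bigr)\prod_{v\in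 V}k_v^{a_v-1}\,\mathbf 1_{(0,\infty)^V}(k),$$ where a single vertex counts as a tree. *)

theory Defs
  imports "HOL-Probability.Probability"
begin

text \<open>
  A finite graph is given by a set of vertices and a set of edges, an edge being the
  two-element set of its ends. Trees are defined here because the digraph library's \<open>tree\<close>
  only excludes directed cycles.
\<close>

definition is_graph :: "'v set \<Rightarrow> 'v set set \<Rightarrow> bool" where
  "is_graph V E \<longleftrightarrow> finite V \<and> (\<forall>e\<in>E. e \<subseteq> V \<and> card e = 2)"

definition induced_edges :: "'v set set \<Rightarrow> 'v set \<Rightarrow> 'v set set" where
  "induced_edges E U = {e \<in> E. e \<subseteq> U}"

definition graph_connected :: "'v set \<Rightarrow> 'v set set \<Rightarrow> bool" where
  "graph_connected V E \<longleftrightarrow> V \<noteq> {} \<and> (\<forall>u\<in>V. \<forall>v\<in>V. (u, v) \<in> {(x, y). {x, y} \<in> E}\<^sup>*)"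

definition graph_cycle :: "'v set set \<Rightarrow> 'v list \<Rightarrow> bool" where
  "graph_cycle E p \<longleftrightarrow> 3 \<le> length p \<and> distinct p \<and>
     (\<forall>i. Suc i < length p \<longrightarrow> {p ! i, p ! Suc i} \<in> E) \<and> {last p, hd p} \<in> E"

definition is_tree :: "'v set \<Rightarrow> 'v set set \<Rightarrow> bool" where
  "is_tree V E \<longleftrightarrow> is_graph V E \<and> graph_connected V E \<and> (\<nexists>p. graph_cycle E p)"

text \<open>
  In the two laws below the vertex set is the whole finite type \<open>'v\<close>, so that vectors indexed
  by the vertices form the Euclidean space \<open>real ^ 'v\<close> with its Lebesgue measure \<open>lborel\<close>.
\<close>

definition vpow :: "real ^ 'v \<Rightarrow> 'v set \<Rightarrow> real" where
  "vpow k U = (\<Prod>v\<in>U. k $ v)"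

definition epow :: "('v set \<Rightarrow> real) \<Rightarrow> 'v set set \<Rightarrow> real" where
  "epow q F = (\<Prod>e\<in>F. q e)"

text \<open>
  The measure with Lebesgue density proportional to \<open>f\<close>, normalised to total mass one. It is a
  probability measure exactly if the nonnegative measurable \<open>f\<close> has an integral in
  \<open>(0, \<infinity>)\<close>; if the integral is infinite it is the zero measure.
\<close>

definition law_prop :: "(real ^ 'v \<Rightarrow> real) \<Rightarrow> (real ^ 'v::finite) measure" where
  "law_prop f =
     density lborel (\<lambda>k. ennreal (f k) / (\<integral>\<^sup>+ x. ennreal (f x) \<partial>lborel))"

definition tree_beta_II ::
  "'v set set \<Rightarrow> real ^ 'v \<Rightarrow> real \<Rightarrow> ('v set \<Rightarrow> real) \<Rightarrow> (real ^ 'v::finite) measure" where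
  "tree_beta_II E a \<beta> q = law_prop (\<lambda>k.
     (\<Sum>U\<in>Pow UNIV. epow q (induced_edges E U) * vpow k U) powr (- \<beta>) *
     (\<Prod>v\<in>UNIV. k $ v powr (a $ v - 1)) * indicator {k. \<forall>v. 0 < k $ v} k)"

definition tree_kummer ::
  "'v set set \<Rightarrow> real ^ 'v \<Rightarrow> real \<Rightarrow> ('v set \<Rightarrow> real) \<Rightarrow> (real ^ 'v::finite) measure" where
  "tree_kummer E a \<beta> q = law_prop (\<lambda>k.
     exp (- \<beta> * (\<Sum>U | U \<noteq> {} \<and> is_tree U (induced_edges E U).
                   epow q (induced_edges E U) * vpow k U)) *
     (\<Prod>v\<in>UNIV. k $ v powr (a $ v - 1)) * indicator {k. \<forall>v. 0 < k $ v} k)"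

text \<open>
  Convergence in distribution, along a filter, of random elements \<open>X i\<close>, each on its own
  probability space \<open>M i\<close>, to the law \<open>\<mu>\<close>: the expectation of every bounded continuous
  function converges. (The library's \<open>weak_conv_m\<close> is for sequences of laws on the real line.)
\<close>

definition converges_in_distribution ::
  "('i \<Rightarrow> 'w measure) \<Rightarrow> ('i \<Rightarrow> 'w \<Rightarrow> 'b::topological_space) \<Rightarrow> 'b measure \<Rightarrow> 'i filter \<Rightarrow> bool"
where
  "converges_in_distribution M X \<mu> F \<longleftrightarrow>
     (\<forall>f :: 'b \<Rightarrow> real. continuous_on UNIV f \<longrightarrow> bounded (range f) \<longrightarrow>
        ((\<lambda>i. \<integral>\<omega>. f (X i \<omega>) \<partial>M i) \<longlongrightarrow> (\<integral>x. f x \<partial>\<mu>)) F)"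

end

theory Submission
  imports Defs
begin

text \<open>
  Rescaling \<open>k = \<epsilon> y\<close>, the term of \<open>U\<close> in the tree-beta density becomes
  \<open>\<epsilon> ^ c(U) q\<^sup>U y\<^sup>U\<close> with \<open>c(U) = |U| - |E\<^sub>U|\<close>, the number of components of the forest \<open>G\<^sub>U\<close>.
  Only the empty set contributes to the constant term and only the subtrees to the linear one, so
  the density converges to \<open>exp (- \<beta> S)\<close>, with \<open>S\<close> the sum over the subtrees, times the
  monomial. The sum is at least \<open>1 + \<epsilon> y\<^sub>v\<close> for each \<open>v\<close>, which bounds the rescaled densities by
  one integrable product function; by dominated convergence the integrals against bounded
  continuous functions and the normalising constants converge.
\<close>

section \<open>Forests and their components\<close>

text \<open>The relation whose closure appears in \<open>graph_connected\<close>; it is symmetric,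
  so reachability is an equivalence and its classes are the connected components.\<close>

definition adj :: "'v set set \<Rightarrow> ('v \<times> 'v) set" where
  "adj E = {(x, y). {x, y} \<in> E}"

definition components :: "'v set \<Rightarrow> 'v set set \<Rightarrow> 'v set set" where
  "components V E = (\<lambda>x. (adj E)\<^sup>* `` {x}) ` V"

lemma adj_sym: "(x, y) \<in> adj E \<Longrightarrow> (y, x) \<in> adj E"
  by (simp add: adj_def insert_commute)

lemma adj_rtrancl_sym: "(x, y) \<in> (adj E)\<^sup>* \<Longrightarrow> (y, x) \<in> (adj E)\<^sup>*"
  by (meson adj_sym symI sym_rtrancl symE)

lemma graph_cycle_mono: "graph_cycle F p \<Longrightarrow> F \<subseteq> E \<Longrightarrow> graph_cycle E p"
  by (auto simp: graph_cycle_def)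

text \<open>Induction along the walk: a step to a vertex already on the path cuts the path back at
  that vertex, any other step prolongs it, so the vertices stay distinct.\<close>

lemma simple_path_of_rtrancl:
  assumes "(u, v) \<in> (adj E)\<^sup>*"
  shows "\<exists>p. p \<noteq> [] \<and> hd p = u \<and> last p = v \<and> distinct p \<and>
           (\<forall>i. Suc i < length p \<longrightarrow> {p ! i, p ! Suc i} \<in> E)"
  using assms
proof (induction rule: rtrancl_induct)
  case base
  show ?case by (rule exI[of _ "[u]"]) simp
next
  case (step y z)
  then obtain p where p: "p \<noteq> []" "hd p = u" "last p = y" "distinct p"
    and pE: "\<And>i. Suc i < length p \<Longrightarrow> {p ! i, p ! Suc i} \<in> E"
    by blast
  show ?case
  proof (cases "z \<in> set p")
    case True
    then obtain k where k: "k < length p" "p ! k = z"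
      by (auto simp: in_set_conv_nth)
    show ?thesis
    proof (intro exI[of _ "take (Suc k) p"] conjI allI impI)
      show "last (take (Suc k) p) = z"
        using k by (simp add: take_Suc_conv_app_nth)
      fix i assume "Suc i < length (take (Suc k) p)"
      then show "{take (Suc k) p ! i, take (Suc k) p ! Suc i} \<in> E"
        using pE[of i] k by simp
    qed (use p in auto)
  next
    case False
    show ?thesis
    proof (intro exI[of _ "p @ [z]"] conjI allI impI)
      fix i assume i: "Suc i < length (p @ [z])"
      show "{(p @ [z]) ! i, (p @ [z]) ! Suc i} \<in> E"
      proof (cases "Suc i < length p")
        case True
        then show ?thesis using pE[of i] by (simp add: nth_append)
      next
        case False
        with i have "i = length p - 1" "p \<noteq> []" using p(1) by auto
        then have "(p @ [z]) ! i = y" "(p @ [z]) ! Suc i = z"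
          using p(1,3) by (auto simp: nth_append last_conv_nth)
        then show ?thesis using step(2) by (simp add: adj_def)
      qed
    qed (use p False in auto)
  qed
qed

text \<open>A simple path from \<open>u\<close> to \<open>v\<close> in \<open>E\<close> closes up
  through the new edge. It has at least three vertices, since one vertex would force
  \<open>u = v\<close> and two would make \<open>{u, v}\<close> an edge of \<open>E\<close>.\<close>

lemma graph_cycle_insert:
  assumes "(u, v) \<in> (adj E)\<^sup>*" "u \<noteq> v" "{u, v} \<notin> E"
  shows "\<exists>p. graph_cycle (insert {u, v} E) p"
proof -
  obtain p where p: "p \<noteq> []" "hd p = u" "last p = v" "distinct p"
    and pE: "\<And>i. Suc i < length p \<Longrightarrow> {p ! i, p ! Suc i} \<in> E"
    using simple_path_of_rtrancl[OF assms(1)] by blast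
  have "length p \<noteq> 0" using p(1) by simp
  moreover have "length p \<noteq> 1"
    using p assms(2) by (auto simp: length_Suc_conv)
  moreover have "length p \<noteq> 2"
  proof
    assume l: "length p = 2"
    then obtain x y where "p = [x, y]"
      by (auto simp: length_Suc_conv numeral_2_eq_2)
    with p pE[of 0] assms(3) show False by simp
  qed
  ultimately have "3 \<le> length p" by linarith
  then have "graph_cycle (insert {u, v} E) p"
    using p pE by (auto simp: graph_cycle_def insert_commute)
  then show ?thesis by blast
qed

text \<open>A path need cross the new edge at most once, so only the classes of its two ends change,
  and they fuse. For \<open>A = B\<close> the formula returns the old components.\<close>

lemma components_insert:
  fixes E :: "'v set set"
  assumes "u \<in> V" "v \<in> V"
  defines "A \<equiv> (adj E)\<^sup>* `` {u}" and "B \<equiv> (adj E)\<^sup>* `` {v}"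
  shows "components V (insert {u, v} E) = insert (A \<union> B) (components V E - {A, B})"
proof -
  define C where "C x = (adj E)\<^sup>* `` {x}" for x
  define C' where "C' x = (adj (insert {u, v} E))\<^sup>* `` {x}" for x
  have sym: "y \<in> C x \<Longrightarrow> x \<in> C y" for x y
    unfolding C_def using adj_rtrancl_sym by fastforce
  have trans: "y \<in> C x \<Longrightarrow> z \<in> C y \<Longrightarrow> z \<in> C x" for x y z
    unfolding C_def by (auto intro: rtrancl_trans)
  have refl: "x \<in> C x" for x by (simp add: C_def)
  have "adj (insert {u, v} E) = insert (u, v) (insert (v, u) (adj E))"
    by (auto simp: adj_def doubleton_eq_iff)
  \<comment> \<open>The edge enters as two directed pairs, each treated by
    \<open>rtrancl_insert\<close>; a path through both pairs only returns to a class already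
    reached.\<close>
  then have mem: "y \<in> C' x \<longleftrightarrow> y \<in> C x \<or> u \<in> C x \<and> y \<in> C v \<or> v \<in> C x \<and> y \<in> C u" for x y
    unfolding C'_def C_def by (auto simp: rtrancl_insert intro: rtrancl_trans)
  have in1: "C' x = C u \<union> C v" if "x \<in> C u \<union> C v" for x
  proof -
    have "y \<in> C' x \<longleftrightarrow> y \<in> C u \<union> C v" for y
      using that mem[of y x] sym[of u x] sym[of v x] sym[of x u] sym[of x v] trans[of u x y] trans[of v x y]
        trans[of x u y] trans[of x v y] by blast
    then show ?thesis by blast
  qed
  have in2: "C' x = C x" if "x \<notin> C u \<union> C v" for x
    using that sym[of u x] sym[of v x] by (auto simp: mem)
  have eq: "C x = C y \<longleftrightarrow> x \<in> C y" for x y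
    using refl[of x] sym[of x y] sym[of y x] trans[of x y] trans[of y x] by blast
  have "C' ` V = insert (C u \<union> C v) (C ` V - {C u, C v})"
  proof (intro equalityI subsetI)
    fix X assume "X \<in> C' ` V"
    then obtain x where "x \<in> V" "X = C' x" by blast
    then show "X \<in> insert (C u \<union> C v) (C ` V - {C u, C v})"
      using in1[of x] in2[of x] eq[of x u] eq[of x v] by (cases "x \<in> C u \<union> C v") auto
  next
    fix X assume "X \<in> insert (C u \<union> C v) (C ` V - {C u, C v})"
    then consider "X = C u \<union> C v" | x where "x \<in> V" "X = C x" "x \<notin> C u \<union> C v"
      using eq by blast
    then show "X \<in> C' ` V"
    proof cases
      case 1
      then have "X = C' u" using in1[of u] refl by blast
      then show ?thesis using assms(1) by blast
    next
      case 2
      then show ?thesis using in2 by blast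
    qed
  qed
  then show ?thesis
    unfolding components_def A_def B_def C_def C'_def .
qed

text \<open>Edges are added one at a time, starting from singleton classes. Acyclicity puts the ends
  of a new edge in different classes, by \<open>graph_cycle_insert\<close>, so each edge lowers the
  number of components by exactly one.\<close>

lemma card_edges_components:
  assumes "finite E" "finite V" "\<forall>e\<in>E. e \<subseteq> V \<and> card e = 2" "\<nexists>p. graph_cycle E p"
  shows "card E + card (components V E) = card V"
  using assms(1,3,4)
proof (induction E)
  case empty
  have "(adj {} :: ('a \<times> 'a) set) = {}" by (auto simp: adj_def)
  then have "components V {} = (\<lambda>x. {x}) ` V" by (simp add: components_def)
  then show ?case by (simp add: card_image)
next
  case (insert e F)
  obtain u v where e: "e = {u, v}" "u \<noteq> v"
    using insert.prems(1) by (auto simp: card_2_iff)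
  then have uv: "u \<in> V" "v \<in> V" using insert.prems(1) by auto
  let ?C = "\<lambda>x. (adj F)\<^sup>* `` {x}"
  have IH: "card F + card (components V F) = card V"
    using insert.prems graph_cycle_mono[of F _ "insert e F"] by (intro insert.IH) blast+
  have v: "v \<notin> ?C u"
    using graph_cycle_insert[of u v F] e insert.hyps(2) insert.prems(2) by auto
  then have ne: "?C u \<noteq> ?C v" by auto
  have sub: "{?C u, ?C v} \<subseteq> components V F" using uv by (auto simp: components_def)
  \<comment> \<open>The fused class must be new for the count: were it an old class,
    \<open>u\<close> and \<open>v\<close> would already be connected.\<close>
  have "?C u \<union> ?C v \<noteq> ?C x" for x
  proof
    assume a: "?C u \<union> ?C v = ?C x"
    have "(x, u) \<in> (adj F)\<^sup>*" "(x, v) \<in> (adj F)\<^sup>*" using a by blast+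
    then have "(u, v) \<in> (adj F)\<^sup>*"
      using adj_rtrancl_sym rtrancl_trans by metis
    then show False using v by simp
  qed
  then have new: "?C u \<union> ?C v \<notin> components V F" by (auto simp: components_def)
  have fin: "finite (components V F)" using assms(2) by (simp add: components_def)
  have "card (components V (insert e F)) = Suc (card (components V F) - 2)"
    using components_insert[OF uv, of F] new fin ne sub e(1)
    by (simp add: card_Diff_subset card_insert_if)
  \<comment> \<open>With at least two classes the truncated subtraction above is exact.\<close>
  moreover have "2 \<le> card (components V F)"
    using card_mono[OF fin sub] ne by simp
  ultimately show ?case using IH insert.hyps by simp
qed

text \<open>Edges inside \<open>V\<close> keep every class inside \<open>V\<close>, so connectedness
  makes all classes equal to \<open>V\<close>; conversely, a single class connects any two
  vertices.\<close>

lemma card_components_eq_1_iff: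
  assumes "V \<noteq> {}" "\<forall>e\<in>E. e \<subseteq> V"
  shows "card (components V E) = 1 \<longleftrightarrow> graph_connected V E"
proof
  assume "card (components V E) = 1"
  then obtain X where "components V E = {X}" by (auto simp: card_1_singleton_iff)
  then have X: "(adj E)\<^sup>* `` {x} = X" if "x \<in> V" for x using that by (auto simp: components_def)
  have "(x, y) \<in> (adj E)\<^sup>*" if "x \<in> V" "y \<in> V" for x y
    using X[OF that(1)] X[OF that(2)] by blast
  then show "graph_connected V E" using assms by (simp add: graph_connected_def adj_def)
next
  assume c: "graph_connected V E"
  have "(adj E)\<^sup>* `` {x} = V" if "x \<in> V" for x
  proof
    have "y \<in> V" if "(x, y) \<in> (adj E)\<^sup>*" for y
      using that by induction (use assms \<open>x \<in> V\<close> in \<open>auto simp: adj_def\<close>)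
    then show "(adj E)\<^sup>* `` {x} \<subseteq> V" by auto
    show "V \<subseteq> (adj E)\<^sup>* `` {x}" using c that by (auto simp: graph_connected_def adj_def)
  qed
  then have "components V E = {V}" using assms(1) by (auto simp: components_def)
  then show "card (components V E) = 1" by simp
qed

text \<open>Acyclicity passes to induced subgraphs, so the forest count applies. It yields the power
  of \<epsilon> that remains when \<open>k\<close> is multiplied and \<open>q\<close> divided by
  \<epsilon>.\<close>

lemma induced_edges_components:
  fixes U :: "'v::finite set"
  assumes "is_tree UNIV E"
  shows "card (induced_edges E U) + card (components U (induced_edges E U)) = card U"
  using assms graph_cycle_mono[of "induced_edges E U" _ E]
  by (intro card_edges_components) (auto simp: is_tree_def is_graph_def induced_edges_def)

text \<open>A nonempty induced subgraph of a tree can fail to be a tree only by being disconnected,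
  which the number of components detects; the empty set has no component.\<close>

lemma is_tree_induced_iff:
  fixes U :: "'v::finite set"
  assumes "is_tree UNIV E"
  shows "U \<noteq> {} \<and> is_tree U (induced_edges E U) \<longleftrightarrow> card (components U (induced_edges E U)) = 1"
proof (cases "U = {}")
  case True
  then show ?thesis by (simp add: components_def)
next
  case False
  have "is_tree U (induced_edges E U) \<longleftrightarrow> graph_connected U (induced_edges E U)"
    using assms graph_cycle_mono[of "induced_edges E U" _ E]
    by (auto simp: is_tree_def is_graph_def induced_edges_def)
  also have "\<dots> \<longleftrightarrow> card (components U (induced_edges E U)) = 1"
    using False by (subst card_components_eq_1_iff) (auto simp: induced_edges_def)
  finally show ?thesis using False by simp
qed

section \<open>Integration\<close>

text \<open>Bernoulli's inequality for real exponents: weighted AM-GM for \<open>1 + r * x\<close>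
  and \<open>1\<close> with weights \<open>1 / r\<close> and \<open>1 - 1 / r\<close>, then raised
  to the power \<open>r\<close>.\<close>

lemma one_plus_mult_le_powr:
  fixes x r :: real
  assumes "0 \<le> x" "1 \<le> r"
  shows "1 + r * x \<le> (1 + x) powr r"
proof -
  have "(1 + r * x) powr (1 / r) * 1 powr (1 - 1 / r) \<le> 1 / r * (1 + r * x) + (1 - 1 / r) * 1"
    using assms by (intro Youngs_inequality_0) (auto simp: add_pos_nonneg)
  also have "1 / r * (1 + r * x) + (1 - 1 / r) * 1 = 1 + x"
    using assms by (simp add: field_simps)
  finally have "(1 + r * x) powr (1 / r) \<le> 1 + x"
    using assms by simp
  then have "((1 + r * x) powr (1 / r)) powr r \<le> (1 + x) powr r"
    using assms by (intro powr_mono2) auto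
  then show ?thesis
    using assms by (simp add: powr_powr)
qed

text \<open>Up to 1 the integrand is at most \<open>x powr (a - 1)\<close>, integrable as
  \<open>a > 0\<close>; beyond 1 the exponents \<open>- (a + 1)\<close> and \<open>a - 1\<close>
  combine to \<open>- 2\<close>. This is the one-variable factor of the dominating function.\<close>

lemma nn_integral_powr_tail_finite:
  fixes a c :: real
  assumes "0 < a" "0 < c"
  shows "(\<integral>\<^sup>+ x. ennreal ((1 + c * x) powr - (a + 1) * x powr (a - 1) * indicator {0<..} x) \<partial>lborel) < \<infinity>"
proof -
  define C where "C = c powr - (a + 1)"
  have C: "0 \<le> C" by (simp add: C_def)
  have le: "(1 + c * x) powr - (a + 1) * x powr (a - 1) * indicator {0<..} x
      \<le> indicator {0..1} x * x powr (a - 1) + C * (1 / x\<^sup>2) * indicator {1..} x" for x :: real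
  proof -
    consider "x \<le> 0" | "0 < x" "x \<le> 1" | "1 < x" by linarith
    then show ?thesis
    proof cases
      case 1 then show ?thesis using C by (auto simp: indicator_def)
    next
      case 2
      have "(1 + c * x) powr - (a + 1) \<le> 1"
        using 2 assms powr_mono2'[of "- (a + 1)" 1 "1 + c * x"] by auto
      then have "(1 + c * x) powr - (a + 1) * x powr (a - 1) \<le> 1 * x powr (a - 1)"
        by (intro mult_right_mono) auto
      then show ?thesis using 2 C by (auto simp: indicator_def)
    next
      case 3
      have "(1 + c * x) powr - (a + 1) \<le> (c * x) powr - (a + 1)"
        using 3 assms by (intro powr_mono2') auto
      then have "(1 + c * x) powr - (a + 1) * x powr (a - 1) \<le> (c * x) powr - (a + 1) * x powr (a - 1)"
        by (intro mult_right_mono) auto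
      also have "\<dots> = C * (x powr - (a + 1) * x powr (a - 1))"
        using 3 assms by (simp add: C_def powr_mult)
      also have "x powr - (a + 1) * x powr (a - 1) = x powr - 2"
        by (simp add: powr_add[symmetric])
      also have "\<dots> = 1 / x\<^sup>2"
        using 3 by (simp add: powr_minus powr_numeral field_simps)
      finally show ?thesis using 3 by (simp add: indicator_def)
    qed
  qed
  have "(\<integral>\<^sup>+ x. ennreal ((1 + c * x) powr - (a + 1) * x powr (a - 1) * indicator {0<..} x) \<partial>lborel)
      \<le> (\<integral>\<^sup>+ x. ennreal (indicator {0..1} x * x powr (a - 1)) + ennreal C * (ennreal (1 / x\<^sup>2) * indicator {1..} x) \<partial>lborel)"
  proof (rule nn_integral_mono)
    fix x :: real
    have "ennreal ((1 + c * x) powr - (a + 1) * x powr (a - 1) * indicator {0<..} x)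
      \<le> ennreal (indicator {0..1} x * x powr (a - 1) + C * (1 / x\<^sup>2) * indicator {1..} x)"
      by (rule ennreal_leI[OF le])
    also have "\<dots> = ennreal (indicator {0..1} x * x powr (a - 1)) + ennreal C * (ennreal (1 / x\<^sup>2) * indicator {1..} x)"
      using C by (subst ennreal_plus) (auto simp: ennreal_mult[symmetric] indicator_def)
    finally show "ennreal ((1 + c * x) powr - (a + 1) * x powr (a - 1) * indicator {0<..} x) \<le> \<dots>" .
  qed
  also have "\<dots> = (\<integral>\<^sup>+ x. ennreal (indicator {0..1} x * x powr (a - 1)) \<partial>lborel)
      + ennreal C * (\<integral>\<^sup>+ x. ennreal (1 / x\<^sup>2) * indicator {1..} x \<partial>lborel)"
    by (subst nn_integral_add) (auto simp: nn_integral_cmult)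
  also have "(\<integral>\<^sup>+ x. ennreal (indicator {0..1} x * x powr (a - 1)) \<partial>lborel) = ennreal (1 / a)"
    using has_integral_powr_from_0[of "a - 1" 1] assms
    by (intro nn_integral_has_integral_lebesgue) auto
  also have "(\<integral>\<^sup>+ x. ennreal (1 / x\<^sup>2) * indicator {1..} x \<partial>lborel) = ennreal (0 - (- 1 / 1))"
  proof (rule nn_integral_FTC_atLeast[where F = "\<lambda>x. - 1 / x"])
    show "((\<lambda>x::real. - 1 / x) \<longlongrightarrow> 0) at_top" by real_asymp
    fix x :: real assume "1 \<le> x"
    then show "((\<lambda>x. - 1 / x) has_real_derivative 1 / x\<^sup>2) (at x)"
      by (auto intro!: derivative_eq_intros simp: power2_eq_square)
  qed auto
  finally show ?thesis
    by (simp add: le_less_trans ennreal_mult_less_top)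
qed

section \<open>Product integrands and positive integrals on Euclidean space\<close>

lemma borel_measurable_vec_nth [measurable]:
  "(\<lambda>k :: real ^ 'v::finite. k $ v) \<in> borel_measurable borel"
  by (intro borel_measurable_continuous_onI continuous_intros)

lemma integrable_prod_vec_nth:
  fixes f :: "'v::finite \<Rightarrow> real \<Rightarrow> real"
  assumes [measurable]: "\<And>v. f v \<in> borel_measurable borel" and nn: "\<And>v x. 0 \<le> f v x"
    and fin: "\<And>v. (\<integral>\<^sup>+ x. ennreal (f v x) \<partial>lborel) < \<infinity>"
  shows "integrable lborel (\<lambda>k :: real ^ 'v. \<Prod>v\<in>UNIV. f v (k $ v))"
proof (rule integrableI_nonneg)
  \<comment> \<open>\<open>nn_integral_lborel_prod\<close> indexes the factors by basis vectors;
    \<open>g\<close> carries them over along the injective map from \<open>v\<close> to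
    \<open>axis v 1\<close>.\<close>
  define g where "g b = f (THE v. b = axis v 1)" for b :: "real ^ 'v"
  have g: "g (axis v 1) = f v" for v
    by (simp add: g_def axis_eq_axis)
  have Basis: "(Basis :: (real ^ 'v) set) = range (\<lambda>v. axis v 1)"
    by (auto simp: Basis_vec_def)
  have inj: "inj (\<lambda>v. axis v 1 :: real ^ 'v)"
    by (auto simp: inj_def axis_eq_axis)
  have "(\<integral>\<^sup>+ k. ennreal (\<Prod>v\<in>UNIV. f v (k $ v)) \<partial>(lborel :: (real ^ 'v) measure)) = 
      (\<integral>\<^sup>+ k. (\<Prod>v\<in>UNIV. ennreal (f v (k \<bullet> axis v 1))) \<partial>(lborel :: (real ^ 'v) measure))"
    by (simp add: prod_ennreal nn inner_axis)
  also have "\<dots> = (\<integral>\<^sup>+ k. (\<Prod>b\<in>Basis. ennreal (g b (k \<bullet> b))) \<partial>(lborel :: (real ^ 'v) measure))"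
    unfolding Basis by (subst prod.reindex[OF inj]) (simp add: g)
  also have "\<dots> = (\<Prod>b\<in>(Basis :: (real ^ 'v) set). \<integral>\<^sup>+ x. ennreal (g b x) \<partial>lborel)"
    by (intro nn_integral_lborel_prod) (auto simp: g_def)
  also have "\<dots> = (\<Prod>v\<in>UNIV. \<integral>\<^sup>+ x. ennreal (f v x) \<partial>lborel)"
    unfolding Basis by (subst prod.reindex[OF inj]) (simp add: g)
  also have "(\<Prod>v\<in>S. \<integral>\<^sup>+ x. ennreal (f v x) \<partial>lborel) < \<infinity>" for S
    using fin by (induction S rule: infinite_finite_induct) (auto simp: ennreal_mult_less_top)
  finally show "(\<integral>\<^sup>+ k. ennreal (\<Prod>v\<in>UNIV. f v (k $ v)) \<partial>(lborel :: (real ^ 'v) measure)) < \<infinity>" .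
qed (auto intro!: prod_nonneg nn)

text \<open>A vanishing integral would make \<open>h\<close> zero almost everywhere, and the
  nonempty open set \<open>S\<close> would be null.\<close>

lemma integral_lborel_pos:
  fixes h :: "'a::euclidean_space \<Rightarrow> real"
  assumes "integrable lborel h" "\<And>x. 0 \<le> h x" "open S" "S \<noteq> {}" "\<And>x. x \<in> S \<Longrightarrow> 0 < h x"
  shows "0 < (\<integral>x. h x \<partial>lborel)"
proof (rule ccontr)
  assume "\<not> ?thesis"
  then have "(\<integral>x. h x \<partial>lborel) = 0"
    using Bochner_Integration.integral_nonneg[of lborel h] assms(2) by (simp add: order.antisym not_less)
  then have "AE x in lborel. h x = 0"
    using integral_nonneg_eq_0_iff_AE[OF assms(1)] assms(2) by simp
  then have "AE x in lborel. x \<notin> S"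
    by eventually_elim (use assms(5) in force)
  then have "S \<in> null_sets lborel"
    using assms(3) by (subst (asm) AE_iff_null_sets[symmetric]) auto
  then show False
    using assms(3,4) open_not_negligible negligible_iff_null_sets null_sets_completionI by blast
qed

section \<open>Normalised laws and their dilations\<close>

lemma law_prop_eq:
  fixes g :: "real ^ 'v::finite \<Rightarrow> real"
  assumes "integrable lborel g" "\<And>k. 0 \<le> g k" "0 < (\<integral>k. g k \<partial>lborel)"
  shows "law_prop g = density lborel (\<lambda>k. ennreal (g k / (\<integral>x. g x \<partial>lborel)))"
  unfolding law_prop_def using assms
  by (subst nn_integral_eq_integral) (auto simp: divide_ennreal)

lemma prob_space_law_prop:
  fixes g :: "real ^ 'v::finite \<Rightarrow> real"
  assumes "integrable lborel g" "\<And>k. 0 \<le> g k" "0 < (\<integral>k. g k \<partial>lborel)"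
  shows "prob_space (law_prop g)"
proof
  have "emeasure (law_prop g) (space (law_prop g)) = (\<integral>\<^sup>+ k. ennreal (g k / (\<integral>x. g x \<partial>lborel)) \<partial>lborel)"
    using assms by (simp add: law_prop_eq emeasure_density)
  also have "\<dots> = ennreal (\<integral>k. g k / (\<integral>x. g x \<partial>lborel) \<partial>lborel)"
    using assms by (intro nn_integral_eq_integral) auto
  finally show "emeasure (law_prop g) (space (law_prop g)) = 1"
    using assms by simp
qed

lemma integral_law_prop:
  fixes g f :: "real ^ 'v::finite \<Rightarrow> real"
  assumes "integrable lborel g" "\<And>k. 0 \<le> g k" "0 < (\<integral>k. g k \<partial>lborel)"
    and [measurable]: "f \<in> borel_measurable borel"
  shows "(\<integral>k. f k \<partial>law_prop g) = (\<integral>k. f k * g k \<partial>lborel) / (\<integral>k. g k \<partial>lborel)"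
proof -
  have [measurable]: "g \<in> borel_measurable borel" using assms(1) by auto
  have "(\<integral>k. f k \<partial>law_prop g) = (\<integral>k. g k / (\<integral>x. g x \<partial>lborel) * f k \<partial>lborel)"
    using assms(1-3) by (simp add: law_prop_eq integral_density)
  then show ?thesis by (simp add: mult.commute)
qed

lemma lborel_integral_scaleR:
  fixes f :: "'a::euclidean_space \<Rightarrow> real"
  assumes [measurable]: "f \<in> borel_measurable borel" and "0 < c"
  shows "(\<integral>x. f x \<partial>lborel) = c ^ DIM('a) * (\<integral>x. f (c *\<^sub>R x) \<partial>lborel)"
proof -
  have "(\<integral>x. f x \<partial>lborel) = (\<integral>x. f x \<partial>density (distr lborel borel (\<lambda>x. 0 + c *\<^sub>R x)) (\<lambda>_. ennreal (\<bar>c\<bar> ^ DIM('a))))"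
    using lborel_affine[of c "0 :: 'a"] assms(2) by simp
  also have "\<dots> = c ^ DIM('a) * (\<integral>x. f (c *\<^sub>R x) \<partial>lborel)"
    using assms(2) by (subst integral_density) (auto simp: integral_distr)
  finally show ?thesis .
qed

lemma lborel_integrable_scaleR:
  fixes f :: "'a::euclidean_space \<Rightarrow> real"
  assumes [measurable]: "f \<in> borel_measurable borel" and "0 < c" "integrable lborel (\<lambda>x. f (c *\<^sub>R x))"
  shows "integrable lborel f"
proof -
  have "integrable (density (distr lborel borel (\<lambda>x. 0 + c *\<^sub>R x)) (\<lambda>_. ennreal (\<bar>c\<bar> ^ DIM('a)))) f"
    using assms(2,3) by (subst integrable_density) (auto simp: integrable_distr_eq)
  then show ?thesis
    using lborel_affine[of c "0 :: 'a"] assms(2) by simp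
qed

text \<open>The dilation multiplies the numerator and the normalising constant by the same factor
  \<open>c ^ CARD('v) * C\<close>, which cancels. Integrability of \<open>g\<close> is inherited
  from \<open>h\<close>.\<close>

lemma integral_law_prop_rescaled:
  fixes g h f :: "real ^ 'v::finite \<Rightarrow> real"
  assumes [measurable]: "g \<in> borel_measurable borel" and nn: "\<And>k. 0 \<le> g k"
    and scale: "\<And>k. g (c *\<^sub>R k) = C * h k" and pos: "0 < c" "0 < C"
    and h: "integrable lborel h" "0 < (\<integral>k. h k \<partial>lborel)"
    and [measurable]: "f \<in> borel_measurable borel"
  shows "(\<integral>k. f ((1 / c) *\<^sub>R k) \<partial>law_prop g) = (\<integral>k. f k * h k \<partial>lborel) / (\<integral>k. h k \<partial>lborel)"
proof -
  have int: "integrable lborel g"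
  proof (rule lborel_integrable_scaleR[OF _ pos(1)])
    show "integrable lborel (\<lambda>k. g (c *\<^sub>R k))" unfolding scale using h(1) by simp
  qed measurable
  have Z: "(\<integral>k. g k \<partial>lborel) = c ^ CARD('v) * C * (\<integral>k. h k \<partial>lborel)"
    using lborel_integral_scaleR[of g c] pos(1) unfolding scale by simp
  have "(\<integral>k. f ((1 / c) *\<^sub>R k) * g k \<partial>lborel)
      = c ^ CARD('v) * (\<integral>k. f ((1 / c) *\<^sub>R c *\<^sub>R k) * g (c *\<^sub>R k) \<partial>lborel)"
    using lborel_integral_scaleR[of "\<lambda>k. f ((1 / c) *\<^sub>R k) * g k" c] pos(1) by simp
  also have "\<dots> = c ^ CARD('v) * (\<integral>k. C * (f k * h k) \<partial>lborel)"
    unfolding scale using pos(1) by (simp add: mult.left_commute)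
  finally have N: "(\<integral>k. f ((1 / c) *\<^sub>R k) * g k \<partial>lborel)
      = c ^ CARD('v) * C * (\<integral>k. f k * h k \<partial>lborel)"
    by simp
  have "(\<integral>k. f ((1 / c) *\<^sub>R k) \<partial>law_prop g)
      = (\<integral>k. f ((1 / c) *\<^sub>R k) * g k \<partial>lborel) / (\<integral>k. g k \<partial>lborel)"
    using pos h(2) by (intro integral_law_prop int nn) (auto simp: Z)
  then show ?thesis
    using pos by (simp add: N Z)
qed

section \<open>Exponential limit of a polynomial raised to a diverging power\<close>

lemma tendsto_poly_powr:
  fixes c :: "'i \<Rightarrow> nat" and w :: "'i \<Rightarrow> real"
  assumes fin: "finite I" and one: "(\<Sum>i | i \<in> I \<and> c i = 0. w i) = 1"
  shows "((\<lambda>\<epsilon>. (\<Sum>i\<in>I. \<epsilon> ^ c i * w i) powr - (\<beta> / \<epsilon>)) \<longlongrightarrow>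
    exp (- \<beta> * (\<Sum>i | i \<in> I \<and> c i = 1. w i))) (at_right 0)"
proof -
  define P where "P \<epsilon> = (\<Sum>i\<in>I. \<epsilon> ^ c i * w i)" for \<epsilon> :: real
  define S where "S = (\<Sum>i | i \<in> I \<and> c i = 1. w i)"
  \<comment> \<open>Since \<open>0 ^ 0 = 1\<close>, evaluation at 0 keeps exactly the terms with
    \<open>c i = 0\<close>.\<close>
  have "P 0 = (\<Sum>i\<in>I. if c i = 0 then w i else 0)"
    unfolding P_def by (intro sum.cong) (auto simp: power_0_left)
  also have "\<dots> = 1"
    using one fin by (simp add: sum.If_cases Int_def)
  finally have P0: "P 0 = 1" .
  have "(P has_real_derivative (\<Sum>i\<in>I. real (c i) * 0 ^ (c i - 1) * w i)) (at 0)"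
    unfolding P_def by (auto intro!: derivative_eq_intros)
  \<comment> \<open>The factor \<open>real (c i)\<close> removes the terms with
    \<open>c i = 0\<close>, where truncated subtraction makes the power \<open>0 ^ 0 = 1\<close>;
    among the others only \<open>c i = 1\<close> survives.\<close>
  also have "(\<Sum>i\<in>I. real (c i) * 0 ^ (c i - 1) * w i) = (\<Sum>i\<in>I. if c i = 1 then w i else 0)"
    by (intro sum.cong) (auto simp: power_0_left)
  also have "\<dots> = S"
    using fin by (simp add: S_def sum.If_cases Int_def)
  finally have DP: "(P has_real_derivative S) (at 0)" .
  \<comment> \<open>As \<open>P 0 = 1\<close>, the logarithm vanishes at 0 and has slope
    \<open>S\<close> there, so \<open>ln (P \<epsilon>) / \<epsilon>\<close> is its difference
    quotient.\<close>
  have "((\<lambda>\<epsilon>. ln (P \<epsilon>)) has_real_derivative S) (at 0)"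
    using DP P0 by (auto intro!: derivative_eq_intros)
  then have "((\<lambda>\<epsilon>. ln (P \<epsilon>) / \<epsilon>) \<longlongrightarrow> S) (at 0)"
    by (simp add: has_field_derivative_iff P0)
  then have "((\<lambda>\<epsilon>. ln (P \<epsilon>) / \<epsilon>) \<longlongrightarrow> S) (at_right 0)"
    by (rule tendsto_mono[rotated]) (simp add: at_le)
  then have "((\<lambda>\<epsilon>. exp (- \<beta> * (ln (P \<epsilon>) / \<epsilon>))) \<longlongrightarrow> exp (- \<beta> * S)) (at_right 0)"
    by (intro tendsto_intros)
  \<comment> \<open>The weights may have any sign, so positivity of the base is secured near 0,
    where \<open>powr\<close> is then the exponential of the logarithm.\<close>
  moreover have "(P \<longlongrightarrow> 1) (at_right 0)"
    using DERIV_isCont[OF DP] P0 by (auto simp: isCont_def intro: tendsto_mono[OF at_le])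
  then have "\<forall>\<^sub>F \<epsilon> in at_right 0. 0 < P \<epsilon>"
    by (rule order_tendstoD) simp
  then have "\<forall>\<^sub>F \<epsilon> in at_right 0. exp (- \<beta> * (ln (P \<epsilon>) / \<epsilon>)) = P \<epsilon> powr - (\<beta> / \<epsilon>)"
    by eventually_elim (simp add: powr_def)
  ultimately show ?thesis
    unfolding P_def S_def by (rule Lim_transform_eventually)
qed

section \<open>The rescaled densities\<close>

definition positive_orthant :: "(real ^ 'v) set" where
  "positive_orthant = {k. \<forall>v. 0 < k $ v}"

lemma open_positive_orthant: "open (positive_orthant :: (real ^ 'v::finite) set)"
proof -
  have eq: "positive_orthant = (\<Inter>v\<in>UNIV. {k :: real ^ 'v. 0 < k $ v})"
    by (auto simp: positive_orthant_def)
  show ?thesis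
    unfolding eq by (intro open_INT ballI open_Collect_less continuous_intros) simp
qed

lemma positive_orthant_nonempty: "(positive_orthant :: (real ^ 'v::finite) set) \<noteq> {}"
proof -
  have "(\<chi> v. 1) \<in> (positive_orthant :: (real ^ 'v::finite) set)"
    by (simp add: positive_orthant_def)
  then show ?thesis by blast
qed

definition num_components :: "'v set set \<Rightarrow> 'v set \<Rightarrow> nat" where
  "num_components E U = card (components U (induced_edges E U))"

text \<open>
  The sum over \<open>U\<close> in the tree-beta density after the substitution \<open>k \<mapsto> \<epsilon> k\<close>,
  \<open>q \<mapsto> q / \<epsilon>\<close>: as \<open>E\<close> is a forest on each \<open>U\<close>, the powers of \<open>\<epsilon>\<close> collect to the
  number of components.
\<close>

definition scaled_sum :: "'v::finite set set \<Rightarrow> ('v set \<Rightarrow> real) \<Rightarrow> real \<Rightarrow> real ^ 'v \<Rightarrow> real" where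
  "scaled_sum E q \<epsilon> k =
     (\<Sum>U\<in>Pow UNIV. \<epsilon> ^ num_components E U * (epow q (induced_edges E U) * vpow k U))"

definition monomial_weight :: "real ^ 'v::finite \<Rightarrow> real ^ 'v \<Rightarrow> real" where
  "monomial_weight a k = (\<Prod>v\<in>UNIV. k $ v powr (a $ v - 1)) * indicator positive_orthant k"

text \<open>The density of the rescaled tree-beta vector, up to a factor independent of
  \<open>k\<close> that normalisation cancels.\<close>

definition beta_density ::
  "'v::finite set set \<Rightarrow> real ^ 'v \<Rightarrow> real \<Rightarrow> ('v set \<Rightarrow> real) \<Rightarrow> real \<Rightarrow> real ^ 'v \<Rightarrow> real" where
  "beta_density E a \<beta> q \<epsilon> k = scaled_sum E q \<epsilon> k powr - (\<beta> / \<epsilon>) * monomial_weight a k"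

definition kummer_density ::
  "'v::finite set set \<Rightarrow> real ^ 'v \<Rightarrow> real \<Rightarrow> ('v set \<Rightarrow> real) \<Rightarrow> real ^ 'v \<Rightarrow> real" where
  "kummer_density E a \<beta> q k =
     exp (- \<beta> * (\<Sum>U | U \<noteq> {} \<and> is_tree U (induced_edges E U).
                   epow q (induced_edges E U) * vpow k U)) * monomial_weight a k"

lemma vpow_measurable [measurable]: "(\<lambda>k :: real ^ 'v::finite. vpow k U) \<in> borel_measurable borel"
  unfolding vpow_def by measurable

lemma monomial_weight_measurable [measurable]:
  "(monomial_weight a :: real ^ 'v::finite \<Rightarrow> real) \<in> borel_measurable borel"
proof -
  have [measurable]: "(positive_orthant :: (real ^ 'v) set) \<in> sets borel"
    by (rule borel_open[OF open_positive_orthant])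
  show ?thesis unfolding monomial_weight_def[abs_def] by measurable
qed

lemma beta_density_measurable [measurable]: "beta_density E a \<beta> q \<epsilon> \<in> borel_measurable borel"
  unfolding beta_density_def[abs_def] scaled_sum_def by measurable

lemma kummer_density_measurable [measurable]: "kummer_density E a \<beta> q \<in> borel_measurable borel"
  unfolding kummer_density_def[abs_def] by measurable

lemma monomial_weight_nonneg: "0 \<le> monomial_weight a k"
  by (simp add: monomial_weight_def prod_nonneg)

lemma monomial_weight_pos: "k \<in> positive_orthant \<Longrightarrow> 0 < monomial_weight a k"
  unfolding monomial_weight_def positive_orthant_def
  by (auto intro!: prod_pos) (metis less_irrefl)

lemma beta_density_nonneg: "0 \<le> beta_density E a \<beta> q \<epsilon> k"
  by (simp add: beta_density_def monomial_weight_nonneg)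

lemma kummer_density_nonneg: "0 \<le> kummer_density E a \<beta> q k"
  by (simp add: kummer_density_def monomial_weight_nonneg)

lemma tree_kummer_eq: "tree_kummer E a \<beta> q = law_prop (kummer_density E a \<beta> q)"
  unfolding tree_kummer_def kummer_density_def[abs_def] monomial_weight_def positive_orthant_def
  by (simp add: mult.assoc)

text \<open>Dilation preserves both the orthant and its complement, so the indicator is unchanged,
  and on the orthant the powers split.\<close>

lemma monomial_weight_scaleR:
  assumes "0 < \<epsilon>"
  shows "monomial_weight a (\<epsilon> *\<^sub>R k) = (\<Prod>v\<in>UNIV. \<epsilon> powr (a $ v - 1)) * monomial_weight a k"
proof (cases "k \<in> positive_orthant")
  case True
  then have "\<epsilon> *\<^sub>R k \<in> positive_orthant"
    using assms by (simp add: positive_orthant_def)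
  then show ?thesis
    using True assms
    by (simp add: monomial_weight_def powr_mult prod.distrib positive_orthant_def less_imp_le)
next
  case False
  then have "\<epsilon> *\<^sub>R k \<notin> positive_orthant"
    using assms by (simp add: positive_orthant_def zero_less_mult_iff)
  then show ?thesis
    using False by (simp add: monomial_weight_def)
qed

section \<open>Scaling, lower bound and pointwise limit for a tree\<close>

context
  fixes E :: "'v::finite set set" and q :: "'v set \<Rightarrow> real"
  assumes tree: "is_tree UNIV E" and q_pos: "\<forall>e\<in>E. 0 < q e"
begin

lemma card_eq_num_components: "card U = card (induced_edges E U) + num_components E U"
  using induced_edges_components[OF tree, of U] by (simp add: num_components_def)

lemma scaled_sum_eq:
  assumes "0 < \<epsilon>"
  shows "(\<Sum>U\<in>Pow UNIV. epow (\<lambda>e. q e / \<epsilon>) (induced_edges E U) * vpow (\<epsilon> *\<^sub>R k) U) = scaled_sum E q \<epsilon> k"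
  unfolding scaled_sum_def
proof (rule sum.cong[OF refl])
  fix U
  have "epow (\<lambda>e. q e / \<epsilon>) (induced_edges E U) = epow q (induced_edges E U) / \<epsilon> ^ card (induced_edges E U)"
    by (simp add: epow_def prod_dividef)
  moreover have "vpow (\<epsilon> *\<^sub>R k) U = \<epsilon> ^ card U * vpow k U"
    by (simp add: vpow_def prod.distrib)
  ultimately show "epow (\<lambda>e. q e / \<epsilon>) (induced_edges E U) * vpow (\<epsilon> *\<^sub>R k) U
      = \<epsilon> ^ num_components E U * (epow q (induced_edges E U) * vpow k U)"
    using assms by (simp add: card_eq_num_components power_add)
qed

lemma induced_edges_empty: "card U \<le> 1 \<Longrightarrow> induced_edges E U = {}"
proof -
  assume U: "card U \<le> 1"
  have "\<not> e \<subseteq> U" if "e \<in> E" for e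
    using card_mono[of U e] U that tree by (auto simp: is_tree_def is_graph_def)
  then show ?thesis by (auto simp: induced_edges_def)
qed

lemma num_components_eq_0_iff: "num_components E U = 0 \<longleftrightarrow> U = {}"
  by (simp add: num_components_def components_def)

lemma num_components_eq_1_iff: "num_components E U = 1 \<longleftrightarrow> U \<noteq> {} \<and> is_tree U (induced_edges E U)"
  using is_tree_induced_iff[OF tree, of U] by (simp add: num_components_def)

lemma epow_pos: "0 < epow q (induced_edges E U)"
  unfolding epow_def by (intro prod_pos) (auto simp: induced_edges_def q_pos)

text \<open>The left side consists of the terms of the empty set and of \<open>{v}\<close>, which
  spans no edge and is one component; all other terms are nonnegative on the orthant.\<close>

lemma scaled_sum_ge:
  assumes "0 < \<epsilon>" "k \<in> positive_orthant"
  shows "1 + \<epsilon> * k $ v \<le> scaled_sum E q \<epsilon> k"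
proof -
  have "num_components E {v} = 1"
    using card_eq_num_components[of "{v}"] by (simp add: induced_edges_empty)
  moreover have "num_components E {} = 0" by (simp add: num_components_eq_0_iff)
  ultimately have "1 + \<epsilon> * k $ v
      = (\<Sum>U\<in>{{}, {v}}. \<epsilon> ^ num_components E U * (epow q (induced_edges E U) * vpow k U))"
    by (simp add: induced_edges_empty epow_def vpow_def)
  also have "\<dots> \<le> scaled_sum E q \<epsilon> k"
    unfolding scaled_sum_def
    using assms
    by (intro sum_mono2) (auto intro!: mult_nonneg_nonneg less_imp_le[OF epow_pos] prod_nonneg
      simp: vpow_def positive_orthant_def less_imp_le)
  finally show ?thesis .
qed

text \<open>In \<open>tendsto_poly_powr\<close> with exponents \<open>num_components\<close>,
  exponent 0 singles out the empty set, whose weight is an empty product, and exponent 1 the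
  subtrees.\<close>

lemma scaled_sum_tendsto:
  "((\<lambda>\<epsilon>. scaled_sum E q \<epsilon> k powr - (\<beta> / \<epsilon>)) \<longlongrightarrow>
     exp (- \<beta> * (\<Sum>U | U \<noteq> {} \<and> is_tree U (induced_edges E U).
                   epow q (induced_edges E U) * vpow k U))) (at_right 0)"
proof -
  have "((\<lambda>\<epsilon>. scaled_sum E q \<epsilon> k powr - (\<beta> / \<epsilon>)) \<longlongrightarrow>
     exp (- \<beta> * (\<Sum>U | U \<in> Pow UNIV \<and> num_components E U = 1.
                   epow q (induced_edges E U) * vpow k U))) (at_right 0)"
    unfolding scaled_sum_def
    by (rule tendsto_poly_powr)
      (simp_all add: num_components_eq_0_iff induced_edges_empty epow_def vpow_def)
  then show ?thesis by (simp add: num_components_eq_1_iff del: One_nat_def)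
qed

lemma beta_density_tendsto:
  "((\<lambda>\<epsilon>. beta_density E a \<beta> q \<epsilon> k) \<longlongrightarrow> kummer_density E a \<beta> q k) (at_right 0)"
  unfolding beta_density_def kummer_density_def by (intro tendsto_mult scaled_sum_tendsto tendsto_const)

text \<open>The scaling hypothesis of \<open>integral_law_prop_rescaled\<close>, with the product of
  the powers of \<epsilon> as the constant \<open>C\<close>.\<close>

lemma tree_beta_II_density_scaleR:
  assumes "0 < \<epsilon>"
  shows "(\<Sum>U\<in>Pow UNIV. epow (\<lambda>e. q e / \<epsilon>) (induced_edges E U) * vpow (\<epsilon> *\<^sub>R k) U) powr - (\<beta> / \<epsilon>)
      * monomial_weight a (\<epsilon> *\<^sub>R k) = (\<Prod>v\<in>UNIV. \<epsilon> powr (a $ v - 1)) * beta_density E a \<beta> q \<epsilon> k"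
  using assms by (simp add: scaled_sum_eq monomial_weight_scaleR beta_density_def del: Pow_UNIV)

section \<open>Uniform domination and passage to the limit\<close>

context
  fixes a :: "real ^ 'v" and \<beta> :: real
  assumes a_pos: "\<And>v. 0 < a $ v" and beta_pos: "0 < \<beta>"
begin

text \<open>
  The exponent \<open>\<beta> / \<epsilon>\<close> is split among the vertices in proportion to \<open>a v + 1\<close>; Bernoulli's
  inequality then makes the bound independent of \<open>\<epsilon>\<close>.
\<close>

lemma beta_density_le:
  defines "c \<equiv> \<beta> / (\<Sum>v\<in>UNIV. a $ v + 1)"
  assumes "0 < \<epsilon>" "\<epsilon> \<le> c"
  shows "beta_density E a \<beta> q \<epsilon> k
    \<le> (\<Prod>v\<in>UNIV. (1 + c * k $ v) powr - (a $ v + 1) * k $ v powr (a $ v - 1) * indicator {0<..} (k $ v))"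
proof (cases "k \<in> positive_orthant")
  case True
  then have k: "0 < k $ v" for v by (simp add: positive_orthant_def)
  have A: "0 < (\<Sum>v\<in>UNIV. a $ v + 1)"
    using a_pos by (intro sum_pos) (auto simp: add_pos_pos)
  have c: "0 < c" using A beta_pos by (simp add: c_def)
  define T where "T = scaled_sum E q \<epsilon> k"
  have T: "1 + \<epsilon> * k $ v \<le> T" for v
    unfolding T_def using assms(2) True by (rule scaled_sum_ge)
  \<comment> \<open>Here \<open>undefined\<close> is just some vertex; any vertex gives
    \<open>T > 1\<close>.\<close>
  have Tpos: "0 < T"
    using T[of undefined] k[of undefined] mult_pos_pos[OF assms(2) k[of undefined]] by linarith
  \<comment> \<open>The constant \<open>c\<close> is chosen so that the shares
    \<open>c * (a $ v + 1)\<close> add up to \<beta>.\<close>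
  have split: "- (\<beta> / \<epsilon>) = (\<Sum>v\<in>UNIV. - (c / \<epsilon> * (a $ v + 1)))"
  proof -
    have "(\<Sum>v\<in>UNIV. - (c / \<epsilon> * (a $ v + 1))) = - (c / \<epsilon> * (\<Sum>v\<in>UNIV. a $ v + 1))"
      by (simp only: sum_negf sum_distrib_left)
    then show ?thesis using A by (simp add: c_def)
  qed
  have factor: "T powr - (c / \<epsilon> * (a $ v + 1)) \<le> (1 + c * k $ v) powr - (a $ v + 1)" for v
  proof -
    have "T powr - (c / \<epsilon> * (a $ v + 1)) \<le> (1 + \<epsilon> * k $ v) powr - (c / \<epsilon> * (a $ v + 1))"
      using T[of v] k[of v] a_pos[of v] assms(2) c
      by (intro powr_mono2') (auto intro!: add_pos_pos mult_nonneg_nonneg)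
    also have "\<dots> = ((1 + \<epsilon> * k $ v) powr (c / \<epsilon>)) powr - (a $ v + 1)"
      by (simp only: powr_powr mult_minus_right)
    also have "\<dots> \<le> (1 + c * k $ v) powr - (a $ v + 1)"
    proof (rule powr_mono2')
      \<comment> \<open>Bernoulli with exponent \<open>c / \<epsilon>\<close>, which is at least 1
        because \<open>\<epsilon> \<le> c\<close>; \<epsilon> cancels on the left.\<close>
      have "1 + c / \<epsilon> * (\<epsilon> * k $ v) \<le> (1 + \<epsilon> * k $ v) powr (c / \<epsilon>)"
        using assms(2,3) k[of v] by (intro one_plus_mult_le_powr) (auto simp: field_simps)
      then show "1 + c * k $ v \<le> (1 + \<epsilon> * k $ v) powr (c / \<epsilon>)"
        using assms(2) by simp
    qed (use a_pos[of v] k[of v] c in \<open>auto intro!: add_pos_pos\<close>)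
    finally show ?thesis .
  qed
  have "T powr - (\<beta> / \<epsilon>) = (\<Prod>v\<in>UNIV. T powr - (c / \<epsilon> * (a $ v + 1)))"
    unfolding split using Tpos by (simp add: powr_sum)
  also have "\<dots> \<le> (\<Prod>v\<in>UNIV. (1 + c * k $ v) powr - (a $ v + 1))"
    by (intro prod_mono conjI factor powr_ge_zero)
  finally have "beta_density E a \<beta> q \<epsilon> k
      \<le> (\<Prod>v\<in>UNIV. (1 + c * k $ v) powr - (a $ v + 1)) * monomial_weight a k"
    unfolding beta_density_def T_def by (intro mult_right_mono monomial_weight_nonneg)
  then show ?thesis
    using True k by (simp add: monomial_weight_def prod.distrib)
next
  case False
  then show ?thesis
    by (simp add: beta_density_def monomial_weight_def prod_nonneg)
qed

text \<open>The bound of \<open>beta_density_le\<close> is a product over the coordinates; giving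
  each vertex the exponent \<open>a $ v + 1\<close> leaves a tail of order \<open>x powr - 2\<close>
  in every factor, hence integrability.\<close>

lemma beta_density_dominated:
  obtains c W where "0 < c" "integrable lborel W"
    "\<And>\<epsilon> k. 0 < \<epsilon> \<Longrightarrow> \<epsilon> \<le> c \<Longrightarrow> beta_density E a \<beta> q \<epsilon> k \<le> W k"
proof -
  define c where "c = \<beta> / (\<Sum>v\<in>UNIV. a $ v + 1)"
  have c: "0 < c"
    using a_pos beta_pos by (auto simp: c_def add_pos_pos intro!: divide_pos_pos sum_pos)
  have "integrable lborel (\<lambda>k :: real ^ 'v. \<Prod>v\<in>UNIV.
      (1 + c * k $ v) powr - (a $ v + 1) * k $ v powr (a $ v - 1) * indicator {0<..} (k $ v))"
    using nn_integral_powr_tail_finite[OF a_pos c]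
    by (intro integrable_prod_vec_nth) auto
  with c show ?thesis
    using beta_density_le[folded c_def] by (rule that)
qed

text \<open>Used twice: a test function \<open>f\<close> gives the numerators of the expectations,
  \<open>f = 1\<close> the normalising constants.\<close>

lemma dominated_limit:
  fixes f :: "real ^ 'v \<Rightarrow> real"
  assumes [measurable]: "f \<in> borel_measurable borel" and "\<And>k. \<bar>f k\<bar> \<le> B"
  shows "integrable lborel (\<lambda>k. f k * kummer_density E a \<beta> q k)"
    and "((\<lambda>\<epsilon>. \<integral>k. f k * beta_density E a \<beta> q \<epsilon> k \<partial>lborel) \<longlongrightarrow>
          (\<integral>k. f k * kummer_density E a \<beta> q k \<partial>lborel)) (at_right 0)"
proof -
  obtain c W where c: "0 < c" and W: "integrable lborel W"
    and le: "\<And>\<epsilon> k. 0 < \<epsilon> \<Longrightarrow> \<epsilon> \<le> c \<Longrightarrow> beta_density E a \<beta> q \<epsilon> k \<le> W k"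
    by (rule beta_density_dominated) blast
  \<comment> \<open>The substitution \<open>\<epsilon> = inverse t\<close> turns the one-sided limit
    at 0 into a limit at infinity, as in \<open>integral_dominated_convergence_at_top\<close>;
    \<open>inverse c \<le> t\<close> then means \<open>\<epsilon> \<le> c\<close>.\<close>
  let ?s = "\<lambda>t k. f k * beta_density E a \<beta> q (inverse t) k"
  have BW: "integrable lborel (\<lambda>k. B * W k)" using W by simp
  have lim: "AE k in lborel. ((\<lambda>t. ?s t k) \<longlongrightarrow> f k * kummer_density E a \<beta> q k) at_top"
    using beta_density_tendsto[of a \<beta>]
    by (intro always_eventually allI tendsto_mult tendsto_const) (simp add: filterlim_at_right_to_top)
  have "\<forall>\<^sub>F t in at_top. 0 < t \<and> inverse c \<le> t"
    using eventually_gt_at_top[of 0] eventually_ge_at_top[of "inverse c"] by eventually_elim simp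
  then have bound: "\<forall>\<^sub>F t in at_top. AE k in lborel. norm (?s t k) \<le> B * W k"
  proof eventually_elim
    case (elim t)
    then have "inverse t \<le> c" using c by (simp add: field_simps)
    then have "\<bar>f k\<bar> * beta_density E a \<beta> q (inverse t) k \<le> B * W k" for k
      using elim assms(2)[of k] beta_density_nonneg[of E a \<beta> q "inverse t" k]
      by (intro mult_mono le) auto
    then show ?case by (simp add: abs_mult beta_density_nonneg)
  qed
  show "integrable lborel (\<lambda>k. f k * kummer_density E a \<beta> q k)"
    by (rule integrable_dominated_convergence_at_top[OF _ _ BW lim bound]) measurable
  show "((\<lambda>\<epsilon>. \<integral>k. f k * beta_density E a \<beta> q \<epsilon> k \<partial>lborel) \<longlongrightarrow>
          (\<integral>k. f k * kummer_density E a \<beta> q k \<partial>lborel)) (at_right 0)"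
    unfolding filterlim_at_right_to_top
    by (rule integral_dominated_convergence_at_top[OF _ _ BW lim bound]) measurable
qed

lemma integrable_beta_density: "\<forall>\<^sub>F \<epsilon> in at_right 0. integrable lborel (beta_density E a \<beta> q \<epsilon>)"
proof -
  obtain c W where c: "0 < c" and W: "integrable lborel W"
    and le: "\<And>\<epsilon> k. 0 < \<epsilon> \<Longrightarrow> \<epsilon> \<le> c \<Longrightarrow> beta_density E a \<beta> q \<epsilon> k \<le> W k"
    by (rule beta_density_dominated) blast
  have "integrable lborel (beta_density E a \<beta> q \<epsilon>)" if "0 < \<epsilon>" "\<epsilon> < c" for \<epsilon>
  proof (rule Bochner_Integration.integrable_bound[OF W])
    show "AE k in lborel. norm (beta_density E a \<beta> q \<epsilon> k) \<le> norm (W k)"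
      using le[of \<epsilon>] that beta_density_nonneg[of E a \<beta> q \<epsilon>]
      by (intro always_eventually allI) (force intro: order_trans)
  qed measurable
  then show ?thesis
    using c by (auto simp: eventually_at_right_field)
qed

lemma integrable_kummer_density: "integrable lborel (kummer_density E a \<beta> q)"
  using dominated_limit(1)[of "\<lambda>_. 1" 1] by simp

lemma integral_kummer_density_pos: "0 < (\<integral>k. kummer_density E a \<beta> q k \<partial>lborel)"
  using integrable_kummer_density kummer_density_nonneg open_positive_orthant positive_orthant_nonempty
  by (rule integral_lborel_pos) (auto simp: kummer_density_def monomial_weight_pos)

text \<open>The normalising constants converge to a positive limit, so they are positive near
  0.\<close>

lemma integral_beta_density_pos: "\<forall>\<^sub>F \<epsilon> in at_right 0. 0 < (\<integral>k. beta_density E a \<beta> q \<epsilon> k \<partial>lborel)"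
  using dominated_limit(2)[of "\<lambda>_. 1" 1] integral_kummer_density_pos
  by (intro order_tendstoD(1)) auto

text \<open>Brings the expectation into the form of a quotient of two integrals, each covered by
  \<open>dominated_limit\<close>.\<close>

lemma integral_tree_beta_II_rescaled:
  assumes "0 < \<epsilon>" "integrable lborel (beta_density E a \<beta> q \<epsilon>)"
    "0 < (\<integral>k. beta_density E a \<beta> q \<epsilon> k \<partial>lborel)" "f \<in> borel_measurable borel"
  shows "(\<integral>k. f ((1 / \<epsilon>) *\<^sub>R k) \<partial>tree_beta_II E a (\<beta> / \<epsilon>) (\<lambda>e. q e / \<epsilon>))
    = (\<integral>k. f k * beta_density E a \<beta> q \<epsilon> k \<partial>lborel) / (\<integral>k. beta_density E a \<beta> q \<epsilon> k \<partial>lborel)"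
proof -
  let ?g = "\<lambda>k. (\<Sum>U\<in>Pow UNIV. epow (\<lambda>e. q e / \<epsilon>) (induced_edges E U) * vpow k U) powr - (\<beta> / \<epsilon>)
      * monomial_weight a k"
  have "tree_beta_II E a (\<beta> / \<epsilon>) (\<lambda>e. q e / \<epsilon>) = law_prop ?g"
    unfolding tree_beta_II_def monomial_weight_def positive_orthant_def by (simp add: mult.assoc)
  moreover have "0 < (\<Prod>v\<in>UNIV. \<epsilon> powr (a $ v - 1))"
    using assms(1) by (intro prod_pos) simp
  moreover have "?g \<in> borel_measurable borel" by measurable
  ultimately show ?thesis
    using assms
    using integral_law_prop_rescaled[of ?g \<epsilon> "\<Prod>v\<in>UNIV. \<epsilon> powr (a $ v - 1)" "beta_density E a \<beta> q \<epsilon>" f]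
      tree_beta_II_density_scaleR[OF assms(1), where a = a and \<beta> = \<beta>] monomial_weight_nonneg[of a]
    by simp
qed

end
end

section \<open>Convergence of the expectations of bounded continuous functions\<close>

theorem theorem5p2:
  fixes E :: "'v::finite set set"
    and q :: "'v set \<Rightarrow> real"
    and a :: "real ^ 'v"
    and \<beta> :: real
    and M :: "real \<Rightarrow> 'w measure"
    and K :: "real \<Rightarrow> 'w \<Rightarrow> real ^ 'v"
  assumes tree: "is_tree (UNIV :: 'v set) E"
    and card: "1 < CARD('v)"
    and q_pos: "\<And>e. e \<in> E \<Longrightarrow> 0 < q e"
    and a_pos: "\<And>v. 0 < a $ v"
    and beta_pos: "0 < \<beta>"
    and prob: "\<And>\<epsilon>. 0 < \<epsilon> \<Longrightarrow> (\<And>v. \<epsilon> * a $ v < \<beta>) \<Longrightarrow> prob_space (M \<epsilon>)"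
    and meas: "\<And>\<epsilon>. 0 < \<epsilon> \<Longrightarrow> (\<And>v. \<epsilon> * a $ v < \<beta>) \<Longrightarrow> K \<epsilon> \<in> borel_measurable (M \<epsilon>)"
    and law: "\<And>\<epsilon>. 0 < \<epsilon> \<Longrightarrow> (\<And>v. \<epsilon> * a $ v < \<beta>) \<Longrightarrow>
       distr (M \<epsilon>) borel (K \<epsilon>) = tree_beta_II E a (\<beta> / \<epsilon>) (\<lambda>e. q e / \<epsilon>)"
  shows "prob_space (tree_kummer E a \<beta> q) \<and>
    converges_in_distribution M (\<lambda>\<epsilon> \<omega>. (1 / \<epsilon>) *\<^sub>R K \<epsilon> \<omega>) (tree_kummer E a \<beta> q) (at_right 0)"
proof
  have "\<forall>e\<in>E. 0 < q e" using q_pos by blast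
  note ctxt = tree this a_pos beta_pos
  note int0 = integrable_kummer_density[OF ctxt]
  note pos0 = integral_kummer_density_pos[OF ctxt]
  show "prob_space (tree_kummer E a \<beta> q)"
    unfolding tree_kummer_eq by (rule prob_space_law_prop[OF int0 kummer_density_nonneg pos0])
  \<comment> \<open>The hypotheses on \<open>M\<close> and \<open>K\<close> apply only for
    admissible \<epsilon>; with finitely many vertices every small \<epsilon> is admissible.\<close>
  have "\<forall>\<^sub>F \<epsilon> in at_right 0. \<epsilon> * a $ v < \<beta>" for v
  proof -
    have "((\<lambda>\<epsilon>. \<epsilon> * a $ v) \<longlongrightarrow> 0 * a $ v) (at_right 0)" by (intro tendsto_intros)
    then show ?thesis using beta_pos by (intro order_tendstoD(2)) auto
  qed
  then have small: "\<forall>\<^sub>F \<epsilon> in at_right 0. \<forall>v. \<epsilon> * a $ v < \<beta>"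
    by (simp add: eventually_all_finite)
  show "converges_in_distribution M (\<lambda>\<epsilon> \<omega>. (1 / \<epsilon>) *\<^sub>R K \<epsilon> \<omega>) (tree_kummer E a \<beta> q) (at_right 0)"
    unfolding converges_in_distribution_def
  proof (intro allI impI)
    fix f :: "real ^ 'v \<Rightarrow> real"
    assume "continuous_on UNIV f" and "bounded (range f)"
    then have [measurable]: "f \<in> borel_measurable borel"
      by (intro borel_measurable_continuous_onI)
    obtain B where B: "\<And>k. \<bar>f k\<bar> \<le> B"
      using \<open>bounded (range f)\<close> by (auto simp: bounded_iff)
    let ?I = "\<lambda>\<epsilon>. (\<integral>k. f k * beta_density E a \<beta> q \<epsilon> k \<partial>lborel) / (\<integral>k. beta_density E a \<beta> q \<epsilon> k \<partial>lborel)"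
    have "(\<integral>k. f k \<partial>tree_kummer E a \<beta> q)
        = (\<integral>k. f k * kummer_density E a \<beta> q k \<partial>lborel) / (\<integral>k. kummer_density E a \<beta> q k \<partial>lborel)"
      unfolding tree_kummer_eq by (rule integral_law_prop[OF int0 kummer_density_nonneg pos0]) measurable
    \<comment> \<open>Numerator and denominator converge separately, and the limit of the
      denominator is nonzero by \<open>pos0\<close>.\<close>
    moreover have "(?I \<longlongrightarrow> \<dots>) (at_right 0)"
      using dominated_limit(2)[OF ctxt, where f = f and B = B]
        dominated_limit(2)[OF ctxt, where f = "\<lambda>_. 1" and B = 1] B pos0
      by (intro tendsto_divide) auto
    \<comment> \<open>An eventual equality suffices for the limit: for small \<epsilon> the law of
      \<open>K \<epsilon>\<close> is known and its density has a finite positive integral.\<close>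
    moreover have "\<forall>\<^sub>F \<epsilon> in at_right 0. ?I \<epsilon> = (\<integral>\<omega>. f ((1 / \<epsilon>) *\<^sub>R K \<epsilon> \<omega>) \<partial>M \<epsilon>)"
      using eventually_at_right_less small integrable_beta_density[OF ctxt] integral_beta_density_pos[OF ctxt]
    proof eventually_elim
      case (elim \<epsilon>)
      have [measurable]: "K \<epsilon> \<in> borel_measurable (M \<epsilon>)" using elim by (intro meas) auto
      have "?I \<epsilon> = (\<integral>k. f ((1 / \<epsilon>) *\<^sub>R k) \<partial>distr (M \<epsilon>) borel (K \<epsilon>))"
        using elim by (subst law) (auto simp: integral_tree_beta_II_rescaled[OF ctxt])
      also have "\<dots> = (\<integral>\<omega>. f ((1 / \<epsilon>) *\<^sub>R K \<epsilon> \<omega>) \<partial>M \<epsilon>)"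
        by (rule integral_distr) measurable
      finally show ?case .
    qed
    ultimately show "((\<lambda>\<epsilon>. \<integral>\<omega>. f ((1 / \<epsilon>) *\<^sub>R K \<epsilon> \<omega>) \<partial>M \<epsilon>) \<longlongrightarrow> (\<integral>k. f k \<partial>tree_kummer E a \<beta> q)) (at_right 0)"
      by (auto intro: Lim_transform_eventually)
  qed
qed

end
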